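(* Let $d=d(q)$ be a function of the prime power $q$ with $d(q)\rightarrow\infty$ as $q\to\infty$. Fix a positive integer $b$. Then for any non-negative integers $m_1,m_2,\dots,m_b$, \[ \lim_{q\rightarrow\infty} \mathbb{M}\big(c_k=m_k \text{ for all } 1\leq k\leq b\big)=\prod_{k=1}^{b}e^{-\frac{1}{k}}\frac{1}{m_k!\,k^{m_k}}. \] That is, the random variables $c_1,\dots,c_b$ are asymptotically independent, with $c_k$ asymptotically Poisson with parameter $1/k$.
   Context: For a prime power $q$ and integer $d\ge 1$, let $\Omega(q,d)$ be the set of all $q^d(q-1)$ polynomials of degree exactly $d$ in $\mathbb{F}_q[x]$, and let $\mathbb{M}=\mathbb{M}_{q,d}$ be the uniform probability measure on $\Omega(q,d)$. For $f\in\Omega(q,d)$, the functional digraph $G_f$ has vertex set $\mathbb{F}_q$ and an edge from $v$ to $f(v)$ for each $v\in\mathbb{F}_q$; $c_k(f)$ denotes the number of cycles of length $k$ in $G_f$. *)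

theory Defs
  imports
    "HOL-Probability.Probability"
    "HOL-Number_Theory.Prime_Powers"
    "HOL-Algebra.Polynomials"
    "Graph_Theory.Arc_Walk"
begin

text \<open>The filter expressing that \<open>q\<close> tends to infinity through the prime powers.\<close>

definition primepow_at_top :: "nat filter" where
  "primepow_at_top = inf at_top (principal {q. primepow q})"

text \<open>
  Polynomials over a ring are the coefficient lists of \<^theory>\<open>HOL-Algebra.Polynomials\<close>.
  As the zero polynomial \<open>[]\<close> has degree \<open>0\<close> there, it is excluded explicitly.
\<close>

definition polys_of_degree :: "('a, 'c) ring_scheme \<Rightarrow> nat \<Rightarrow> 'a list set" where
  "polys_of_degree R d =
     {f. polynomial\<^bsub>R\<^esub> (carrier R) f \<and> f \<noteq> [] \<and> Polynomials.degree f = d}"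

definition poly_measure :: "('a, 'c) ring_scheme \<Rightarrow> nat \<Rightarrow> 'a list measure" where
  "poly_measure R d = uniform_count_measure (polys_of_degree R d)"

definition functional_digraph :: "('a, 'c) ring_scheme \<Rightarrow> 'a list \<Rightarrow> ('a, 'a \<times> 'a) pre_digraph" where
  "functional_digraph R f =
     \<lparr>verts = carrier R, arcs = {(v, ring.eval R f v) | v. v \<in> carrier R}, tail = fst, head = snd\<rparr>"

text \<open>
  \<^const>\<open>pre_digraph.cycle\<close> is a predicate on arc lists, so that a directed cycle of length
  \<open>k\<close> satisfies it in \<open>k\<close> rotated forms. Passing to the set of arcs identifies exactly these
  rotations. Loops count as cycles of length \<open>1\<close>.
\<close>

definition cycle_count :: "('a, 'c) ring_scheme \<Rightarrow> nat \<Rightarrow> 'a list \<Rightarrow> nat" where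
  "cycle_count R k f =
     card {set p | p. pre_digraph.cycle (functional_digraph R f) p \<and> length p = k}"

end

theory Submission
  imports Defs
begin

text \<open>
  The proof is by the method of moments. A polynomial of degree \<open>d\<close> takes prescribed values at
  \<open>s \<le> d\<close> distinct points with probability exactly \<open>q\<^sup>-\<^sup>s\<close>, since adding an interpolating polynomial of degree
  below \<open>d\<close> permutes the value patterns. Listing \<open>r\<^sub>k\<close> distinct \<open>k\<close>-cycles for each \<open>k\<close>, with a starting
  point on each, is the same as choosing \<open>s = \<Sum>k r\<^sub>k\<close> distinct points with prescribed images. Counting these
  lists gives the joint factorial moments of the cycle counts as \<open>q(q-1)\<dots>(q-s+1)/q\<^sup>s\<close> divided by \<open>\<Prod>\<^sub>k k^r\<^sub>k\<close>, which tend
  to those of independent Poisson variables; the Bonferroni inequalities turn this into convergence of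
  probabilities.
\<close>

subsection \<open>Poisson convergence from factorial moments\<close>

text \<open>Pascal's rule makes the sum telescope. At \<open>N = 0\<close> the left side is always
  1, while the right side vanishes for \<open>J > 0\<close>.\<close>

lemma alternating_binomial_partial_sum:
  assumes "N > 0"
  shows "(\<Sum>j\<le>J. (-1) ^ j * real (N choose j)) = (-1) ^ J * real ((N - 1) choose J)"
proof (induction J)
  case (Suc J)
  obtain M where "N = Suc M" using assms gr0_implies_Suc by blast
  with Suc show ?case by (simp add: algebra_simps)
qed simp

text \<open>Rewriting the product of binomials as \<open>(n choose m) * ((n - m) choose j)\<close>
  for \<open>m \<le> n\<close> reduces the sum to a truncated alternating row of Pascal's triangle.
  The error of this truncated inclusion-exclusion is at most the first omitted term.\<close>

lemma bonferroni:
  "\<bar>(\<Sum>j\<le>J. (-1) ^ j * real ((m + j) choose m) * real (n choose (m + j))) - of_bool (n = m)\<bar>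
     \<le> real ((m + J + 1) choose m) * real (n choose (m + J + 1))"
proof -
  have shift: "((m + j) choose m) * (n choose (m + j)) = (n choose m) * ((n - m) choose j)" if "m \<le> n" for j
  proof (cases "m + j \<le> n")
    case True
    then show ?thesis using choose_mult[of m "m + j" n] by (simp add: mult.commute)
  qed (use that in \<open>auto simp: binomial_eq_0\<close>)
  consider "n < m" | "n = m" | "n > m" by linarith
  then show ?thesis
  proof cases
    case 1
    then show ?thesis by (simp add: binomial_eq_0)
  next
    case 2
    have "(\<Sum>j\<le>J. (-1) ^ j * real ((m + j) choose m) * real (n choose (m + j))) = (\<Sum>j\<le>J. of_bool (j = 0))"
      using 2 by (intro sum.cong) (auto simp: binomial_eq_0)
    also have "\<dots> = 1" by (simp add: of_bool_def)
    finally show ?thesis using 2 by simp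
  next
    case 3
    have eq: "real ((m + j) choose m) * real (n choose (m + j)) = real (n choose m) * real ((n - m) choose j)" for j
      using shift[of j] 3 by (metis of_nat_mult less_imp_le)
    have "(\<Sum>j\<le>J. (-1) ^ j * real ((m + j) choose m) * real (n choose (m + j)))
        = real (n choose m) * (\<Sum>j\<le>J. (-1) ^ j * real ((n - m) choose j))"
      unfolding sum_distrib_left by (intro sum.cong) (auto simp: eq mult.assoc)
    also have "\<dots> = real (n choose m) * ((-1) ^ J * real ((n - m - 1) choose J))"
      using 3 by (subst alternating_binomial_partial_sum) auto
    finally have "\<bar>(\<Sum>j\<le>J. (-1) ^ j * real ((m + j) choose m) * real (n choose (m + j))) - of_bool (n = m)\<bar>
        = real (n choose m) * real ((n - m - 1) choose J)"
      using 3 by (simp add: abs_mult)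
    also have "\<dots> \<le> real (n choose m) * real ((n - m) choose (J + 1))"
    proof -
      obtain M where "n - m = Suc M" using 3 by (metis Suc_diff_Suc)
      then show ?thesis by (intro mult_left_mono) auto
    qed
    also have "\<dots> = real ((m + J + 1) choose m) * real (n choose (m + J + 1))"
      using eq[of "J + 1"] by (simp add: add.assoc)
    finally show ?thesis .
  qed
qed

text \<open>Factors are exchanged one at a time, with \<open>prod x K\<close> bounded through the
  induction hypothesis. Keeping the bound as a product lets its average again be expanded into joint
  binomial moments.\<close>

lemma abs_prod_diff_le:
  fixes x y e :: "'k \<Rightarrow> real"
  assumes "finite K" and "\<And>k. k \<in> K \<Longrightarrow> \<bar>x k - y k\<bar> \<le> e k" and "\<And>k. k \<in> K \<Longrightarrow> \<bar>y k\<bar> \<le> 1"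
  shows "\<bar>prod x K - prod y K\<bar> \<le> (\<Prod>k\<in>K. 1 + e k) - 1"
  using assms
proof (induction K rule: finite_induct)
  case (insert i K)
  let ?P = "\<Prod>k\<in>K. 1 + e k"
  have IH: "\<bar>prod x K - prod y K\<bar> \<le> ?P - 1" using insert by auto
  have "\<bar>prod y K\<bar> \<le> 1"
    unfolding abs_prod by (rule prod_le_1) (use insert in auto)
  then have X: "\<bar>prod x K\<bar> \<le> ?P" using IH by linarith
  have "x i * prod x K - y i * prod y K = (x i - y i) * prod x K + y i * (prod x K - prod y K)"
    by (simp add: algebra_simps)
  then have "\<bar>x i * prod x K - y i * prod y K\<bar> \<le> \<bar>x i - y i\<bar> * \<bar>prod x K\<bar> + \<bar>y i\<bar> * \<bar>prod x K - prod y K\<bar>"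
    by (metis abs_mult abs_triangle_ineq)
  also have "\<dots> \<le> e i * ?P + 1 * (?P - 1)"
    using insert.prems X IH by (intro add_mono mult_mono) (auto intro: order_trans[OF abs_ge_zero])
  also have "\<dots> = (1 + e i) * ?P - 1" by (simp add: algebra_simps)
  finally show ?case using insert by simp
qed simp

text \<open>Expanding the product of sums over the choice functions in \<open>PiE K D\<close> turns
  the average into a finite linear combination of joint binomial moments, each with a known
  limit.\<close>

lemma tendsto_average_prod_binomial_combination:
  fixes c :: "'q \<Rightarrow> 'k \<Rightarrow> 'f \<Rightarrow> nat" and \<alpha> :: "'k \<Rightarrow> 'j \<Rightarrow> real"
  assumes K: "finite K" and D: "\<And>k. k \<in> K \<Longrightarrow> finite (D k)"
    and moments: "\<And>r. ((\<lambda>q. (\<Sum>f\<in>\<Omega> q. \<Prod>k\<in>K. real (c q k f choose r k)) / real (card (\<Omega> q)))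
            \<longlongrightarrow> (\<Prod>k\<in>K. l k ^ r k / fact (r k))) Q"
  shows "((\<lambda>q. (\<Sum>f\<in>\<Omega> q. \<Prod>k\<in>K. \<Sum>j\<in>D k. \<alpha> k j * real (c q k f choose e k j)) / real (card (\<Omega> q)))
            \<longlongrightarrow> (\<Prod>k\<in>K. \<Sum>j\<in>D k. \<alpha> k j * (l k ^ e k j / fact (e k j)))) Q"
proof -
  have "(\<Sum>f\<in>\<Omega> q. \<Prod>k\<in>K. \<Sum>j\<in>D k. \<alpha> k j * real (c q k f choose e k j)) / real (card (\<Omega> q))
      = (\<Sum>g\<in>PiE K D. (\<Prod>k\<in>K. \<alpha> k (g k)) *
          ((\<Sum>f\<in>\<Omega> q. \<Prod>k\<in>K. real (c q k f choose e k (g k))) / real (card (\<Omega> q))))" for q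
    by (simp add: prod_sum_PiE K D sum.swap[of _ "\<Omega> q"] prod.distrib sum_divide_distrib sum_distrib_left)
  moreover have "((\<lambda>q. \<Sum>g\<in>PiE K D. (\<Prod>k\<in>K. \<alpha> k (g k)) *
          ((\<Sum>f\<in>\<Omega> q. \<Prod>k\<in>K. real (c q k f choose e k (g k))) / real (card (\<Omega> q))))
       \<longlongrightarrow> (\<Sum>g\<in>PiE K D. (\<Prod>k\<in>K. \<alpha> k (g k)) * (\<Prod>k\<in>K. l k ^ e k (g k) / fact (e k (g k))))) Q"
    by (intro tendsto_intros moments)
  moreover have "(\<Sum>g\<in>PiE K D. (\<Prod>k\<in>K. \<alpha> k (g k)) * (\<Prod>k\<in>K. l k ^ e k (g k) / fact (e k (g k))))
      = (\<Prod>k\<in>K. \<Sum>j\<in>D k. \<alpha> k j * (l k ^ e k j / fact (e k j)))"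
    by (simp add: prod_sum_PiE K D flip: prod.distrib)
  ultimately show ?thesis by simp
qed

lemma binomial_mult_power_div_fact:
  "real ((m + j) choose m) * (x ^ (m + j) / fact (m + j)) = (x ^ m / fact m) * (x ^ j / fact j)"
  by (simp add: binomial_fact power_add field_simps)

text \<open>The assumed limits are the joint binomial moments of independent Poisson variables with
  parameters \<open>l k\<close>. They give limits for the averaged Bonferroni sums and for their
  error bounds, and the error vanishes as the cut-off \<open>J\<close> grows.\<close>

lemma poisson_method_of_moments:
  fixes c :: "'q \<Rightarrow> 'k \<Rightarrow> 'f \<Rightarrow> nat" and l :: "'k \<Rightarrow> real"
  assumes K: "finite K"
    and moments: "\<And>r. ((\<lambda>q. (\<Sum>f\<in>\<Omega> q. \<Prod>k\<in>K. real (c q k f choose r k)) / real (card (\<Omega> q)))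
            \<longlongrightarrow> (\<Prod>k\<in>K. l k ^ r k / fact (r k))) Q"
  shows "((\<lambda>q. real (card {f \<in> \<Omega> q. \<forall>k\<in>K. c q k f = m k}) / real (card (\<Omega> q)))
            \<longlongrightarrow> (\<Prod>k\<in>K. exp (- l k) * (l k ^ m k / fact (m k)))) Q"
    (is "(?p \<longlongrightarrow> ?L) Q")
proof -
  \<comment> \<open>\<open>T\<close> is the Bonferroni sum cut off at \<open>J\<close> and
    \<open>E\<close> its first omitted term; \<open>t J\<close> and \<open>\<epsilon> J\<close> are
    the limits of the averaged products of \<open>T\<close> and of \<open>1 + E\<close>.\<close>
  define T where "T J k n = (\<Sum>j\<le>J. (-1) ^ j * real ((m k + j) choose m k) * real (n choose (m k + j)))" for J k n
  define E where "E J k n = real ((m k + J + 1) choose m k) * real (n choose (m k + J + 1))" for J k n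
  define avg where "avg q g = (\<Sum>f\<in>\<Omega> q. g f) / real (card (\<Omega> q))" for q and g :: "'f \<Rightarrow> real"
  define t where "t J = (\<Prod>k\<in>K. \<Sum>j\<le>J. (-1) ^ j * real ((m k + j) choose m k) * (l k ^ (m k + j) / fact (m k + j)))" for J
  define \<epsilon> where "\<epsilon> J = (\<Prod>k\<in>K. 1 + real ((m k + J + 1) choose m k) * (l k ^ (m k + J + 1) / fact (m k + J + 1)))" for J
  have limT: "((\<lambda>q. avg q (\<lambda>f. \<Prod>k\<in>K. T J k (c q k f))) \<longlongrightarrow> t J) Q" for J
    unfolding avg_def T_def t_def
    using tendsto_average_prod_binomial_combination[where D = "\<lambda>_. {..J}" and e = "\<lambda>k j. m k + j"
        and \<alpha> = "\<lambda>k j. (-1) ^ j * real ((m k + j) choose m k)", OF K _ moments] by simp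
  have limE: "((\<lambda>q. avg q (\<lambda>f. \<Prod>k\<in>K. 1 + E J k (c q k f))) \<longlongrightarrow> \<epsilon> J) Q" for J
    \<comment> \<open>The factor \<open>1 + E\<close> is a two-term combination:
      \<open>False\<close> stands for the constant 1, as a binomial coefficient with lower index 0,
      and \<open>True\<close> for \<open>E\<close>.\<close>
    using tendsto_average_prod_binomial_combination[where D = "\<lambda>_. {False, True}"
        and \<alpha> = "\<lambda>k j. if j then real ((m k + J + 1) choose m k) else 1"
        and e = "\<lambda>k j. if j then m k + J + 1 else 0", OF K _ moments]
    by (simp add: avg_def E_def \<epsilon>_def)
  \<comment> \<open>The average of 1 is 1 only when \<open>\<Omega> q\<close> is finite and
    nonempty; the moment with all exponents 0 supplies the limit.\<close>
  have lim1: "((\<lambda>q. avg q (\<lambda>f. 1)) \<longlongrightarrow> 1) Q"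
    using moments[of "\<lambda>_. 0"] by (simp add: avg_def)
  have bound: "\<bar>?p q - avg q (\<lambda>f. \<Prod>k\<in>K. T J k (c q k f))\<bar>
      \<le> avg q (\<lambda>f. \<Prod>k\<in>K. 1 + E J k (c q k f)) - avg q (\<lambda>f. 1)" for q J
  proof (cases "card (\<Omega> q) = 0")
    case True
    show ?thesis unfolding avg_def True by (simp only: of_nat_0 div_by_0 diff_self abs_zero order_refl)
  next
    case False
    then have fin: "finite (\<Omega> q)" by (rule card_ge_0_finite[OF neq0_conv[THEN iffD1]])
    have "real (card {f \<in> \<Omega> q. \<forall>k\<in>K. c q k f = m k}) = (\<Sum>f\<in>\<Omega> q. \<Prod>k\<in>K. of_bool (c q k f = m k))"
    proof -
      have "(\<Prod>k\<in>K. of_bool (c q k f = m k)) = (of_bool (\<forall>k\<in>K. c q k f = m k) :: real)" for f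
        using K by (induction K rule: finite_induct) auto
      moreover have "{f \<in> \<Omega> q. \<forall>k\<in>K. c q k f = m k} = \<Omega> q \<inter> {f. \<forall>k\<in>K. c q k f = m k}" by blast
      ultimately show ?thesis using fin by simp
    qed
    then have "\<bar>?p q - avg q (\<lambda>f. \<Prod>k\<in>K. T J k (c q k f))\<bar>
      = \<bar>\<Sum>f\<in>\<Omega> q. (\<Prod>k\<in>K. T J k (c q k f)) - (\<Prod>k\<in>K. of_bool (c q k f = m k))\<bar> / real (card (\<Omega> q))"
      unfolding avg_def sum_subtractf diff_divide_distrib[symmetric] abs_divide
      by (simp add: abs_minus_commute)
    also have "\<dots> \<le> (\<Sum>f\<in>\<Omega> q. (\<Prod>k\<in>K. 1 + E J k (c q k f)) - 1) / real (card (\<Omega> q))"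
    proof (rule divide_right_mono)
      have "\<bar>(\<Prod>k\<in>K. T J k (c q k f)) - (\<Prod>k\<in>K. of_bool (c q k f = m k))\<bar> \<le> (\<Prod>k\<in>K. 1 + E J k (c q k f)) - 1" for f
      proof (rule abs_prod_diff_le[OF K])
        show "\<bar>T J k (c q k f) - of_bool (c q k f = m k)\<bar> \<le> E J k (c q k f)" for k
          unfolding T_def E_def by (rule bonferroni)
      qed simp
      then show "\<bar>\<Sum>f\<in>\<Omega> q. (\<Prod>k\<in>K. T J k (c q k f)) - (\<Prod>k\<in>K. of_bool (c q k f = m k))\<bar>
          \<le> (\<Sum>f\<in>\<Omega> q. (\<Prod>k\<in>K. 1 + E J k (c q k f)) - 1)"
        by (intro order_trans[OF sum_abs] sum_mono)
    qed simp
    also have "\<dots> = avg q (\<lambda>f. \<Prod>k\<in>K. 1 + E J k (c q k f)) - avg q (\<lambda>f. 1)"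
      by (simp add: avg_def sum_subtractf diff_divide_distrib)
    finally show ?thesis .
  qed
  \<comment> \<open>After separating the factor \<open>l k ^ m k / fact (m k)\<close>, what remains
    is a partial sum of the exponential series at \<open>- l k\<close>.\<close>
  have "t \<longlonglongrightarrow> ?L"
  proof -
    have "t J = (\<Prod>k\<in>K. (l k ^ m k / fact (m k)) * (\<Sum>j\<le>J. (- l k) ^ j / fact j))" for J
    proof -
      have "(-1) ^ j * real ((m k + j) choose m k) * (l k ^ (m k + j) / fact (m k + j))
          = (l k ^ m k / fact (m k)) * ((- l k) ^ j / fact j)" for k j
        using arg_cong[OF binomial_mult_power_div_fact[of "m k" j "l k"], of "(*) ((-1) ^ j)"]
        by (simp add: power_minus[of "l k"] mult_ac)
      then show ?thesis unfolding t_def by (simp add: sum_distrib_left)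
    qed
    then have t_eq: "t = (\<lambda>J. \<Prod>k\<in>K. (l k ^ m k / fact (m k)) * (\<Sum>j\<le>J. (- l k) ^ j / fact j))" ..
    have "(\<lambda>J. \<Sum>j\<le>J. (- l k) ^ j / fact j) \<longlonglongrightarrow> exp (- l k)" for k
      using exp_converges[of "- l k"] unfolding sums_def_le by (simp add: divide_inverse mult.commute)
    then have "t \<longlonglongrightarrow> (\<Prod>k\<in>K. (l k ^ m k / fact (m k)) * exp (- l k))"
      unfolding t_eq by (intro tendsto_prod tendsto_mult tendsto_const)
    then show ?thesis by (simp add: mult.commute)
  qed
  moreover have "\<epsilon> \<longlonglongrightarrow> 1"
  proof -
    have "\<epsilon> J = (\<Prod>k\<in>K. 1 + (l k ^ m k / fact (m k)) * (l k ^ (Suc J) / fact (Suc J)))" for J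
    proof -
      have "real ((m k + J + 1) choose m k) * (l k ^ (m k + J + 1) / fact (m k + J + 1))
          = (l k ^ m k / fact (m k)) * (l k ^ (Suc J) / fact (Suc J))" for k
        using binomial_mult_power_div_fact[of "m k" "Suc J" "l k"] by (simp only: Suc_eq_plus1 add.assoc)
      then show ?thesis unfolding \<epsilon>_def by (simp only:)
    qed
    then have \<epsilon>_eq: "\<epsilon> = (\<lambda>J. \<Prod>k\<in>K. 1 + (l k ^ m k / fact (m k)) * (l k ^ (Suc J) / fact (Suc J)))" ..
    have zero: "(\<lambda>J. l k ^ (Suc J) / fact (Suc J)) \<longlonglongrightarrow> 0" for k
      using LIMSEQ_Suc[OF summable_LIMSEQ_zero[OF summable_exp[of "l k"]]]
      by (simp only: divide_inverse mult.commute)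
    have "\<epsilon> \<longlonglongrightarrow> (\<Prod>k\<in>K. 1 + (l k ^ m k / fact (m k)) * 0)"
      unfolding \<epsilon>_eq by (intro tendsto_prod tendsto_add tendsto_mult tendsto_const zero)
    then show ?thesis by simp
  qed
  ultimately have "(\<lambda>J. \<bar>t J - ?L\<bar> + (\<epsilon> J - 1)) \<longlonglongrightarrow> \<bar>?L - ?L\<bar> + (1 - 1)"
    by (intro tendsto_add tendsto_diff tendsto_rabs tendsto_const)
  then have err: "(\<lambda>J. \<bar>t J - ?L\<bar> + (\<epsilon> J - 1)) \<longlonglongrightarrow> 0" by simp
  show ?thesis
  proof (rule tendstoI)
    fix x :: real assume "x > 0"
    \<comment> \<open>The cut-off \<open>J\<close> is fixed before \<open>q\<close> varies, so that
      limits at a single \<open>J\<close> are enough.\<close>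
    then obtain J where J: "\<bar>t J - ?L\<bar> + (\<epsilon> J - 1) < x"
      using eventually_happens[OF order_tendstoD(2)[OF err]] by auto
    have "((\<lambda>q. avg q (\<lambda>f. \<Prod>k\<in>K. 1 + E J k (c q k f)) - avg q (\<lambda>f. 1)
        + \<bar>avg q (\<lambda>f. \<Prod>k\<in>K. T J k (c q k f)) - ?L\<bar>) \<longlongrightarrow> (\<epsilon> J - 1) + \<bar>t J - ?L\<bar>) Q"
      by (intro tendsto_intros limT limE lim1)
    then have "\<forall>\<^sub>F q in Q. avg q (\<lambda>f. \<Prod>k\<in>K. 1 + E J k (c q k f)) - avg q (\<lambda>f. 1)
        + \<bar>avg q (\<lambda>f. \<Prod>k\<in>K. T J k (c q k f)) - ?L\<bar> < x"
      by (rule order_tendstoD(2)) (use J in linarith)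
    then show "\<forall>\<^sub>F q in Q. dist (?p q) ?L < x"
    proof eventually_elim
      case (elim q)
      then show ?case using bound[of q J] unfolding dist_real_def by linarith
    qed
  qed
qed

subsection \<open>Counting rooted cycles\<close>

text \<open>With \<open>ys\<close> cut into consecutive blocks of lengths \<open>ks\<close>, this
  lists the images that the entries must have for every block to be a cycle: the next entry of the
  block, and the first after the last.\<close>

primrec rotate_blocks :: "nat list \<Rightarrow> 'a list \<Rightarrow> 'a list" where
  "rotate_blocks [] ys = []"
| "rotate_blocks (k # ks) ys = rotate1 (take k ys) @ rotate_blocks ks (drop k ys)"

lemma length_rotate_blocks: "length ys = sum_list ks \<Longrightarrow> length (rotate_blocks ks ys) = length ys"
  by (induction ks arbitrary: ys) auto

lemma set_rotate_blocks: "length ys = sum_list ks \<Longrightarrow> set (rotate_blocks ks ys) = set ys"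
proof (induction ks arbitrary: ys)
  case (Cons k ks)
  then have "set (rotate_blocks ks (drop k ys)) = set (drop k ys)" by simp
  moreover have "set ys = set (take k ys) \<union> set (drop k ys)" by (metis append_take_drop_id set_append)
  ultimately show ?case by simp
qed simp

text \<open>Each cycle of length \<open>k > 0\<close> is listed \<open>k\<close> times here, once for each starting point.\<close>

definition rooted_cycles :: "'a set \<Rightarrow> ('a \<Rightarrow> 'a) \<Rightarrow> nat \<Rightarrow> 'a list set" where
  "rooted_cycles V f k = {xs. length xs = k \<and> distinct xs \<and> set xs \<subseteq> V \<and> map f xs = rotate1 xs}"

text \<open>Concatenating the cycles into one list makes distinctness express their disjointness,
  and makes being a family a prescription of values at \<open>sum_list ks\<close> distinct
  points.\<close>

definition rooted_cycle_families :: "'a set \<Rightarrow> ('a \<Rightarrow> 'a) \<Rightarrow> nat list \<Rightarrow> 'a list set" where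
  "rooted_cycle_families V f ks =
     {ys. length ys = sum_list ks \<and> distinct ys \<and> set ys \<subseteq> V \<and> map f ys = rotate_blocks ks ys}"

lemma finite_rooted_cycles: "finite V \<Longrightarrow> finite (rooted_cycles V f k)"
  unfolding rooted_cycles_def by (rule finite_subset[OF _ finite_lists_length_eq[of V k]]) auto

lemma finite_rooted_cycle_families: "finite V \<Longrightarrow> finite (rooted_cycle_families V f ks)"
  unfolding rooted_cycle_families_def
  by (rule finite_subset[OF _ finite_lists_length_eq[of V "sum_list ks"]]) auto

lemma rooted_cycle_families_Nil: "rooted_cycle_families V f [] = {[]}"
  by (auto simp: rooted_cycle_families_def)

text \<open>Cut after the first \<open>k\<close> entries. The tail is the outer index, so that the
  possible first cycles can be counted with the others fixed.\<close>

lemma rooted_cycle_families_Cons: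
  "rooted_cycle_families V f (k # ks) =
     (\<lambda>(ys, xs). xs @ ys) ` (SIGMA ys:rooted_cycle_families V f ks. {xs \<in> rooted_cycles V f k. set xs \<inter> set ys = {}})"
proof (intro subset_antisym subsetI)
  fix zs assume zs: "zs \<in> rooted_cycle_families V f (k # ks)"
  define xs ys where "xs = take k zs" and "ys = drop k zs"
  have zs_eq: "zs = xs @ ys" and len: "length xs = k" "length ys = sum_list ks"
    using zs by (auto simp: xs_def ys_def rooted_cycle_families_def)
  have "map f xs @ map f ys = rotate1 xs @ rotate_blocks ks ys"
    using zs by (simp add: zs_eq len rooted_cycle_families_def)
  then have "map f xs = rotate1 xs" "map f ys = rotate_blocks ks ys" by simp_all
  then have "ys \<in> rooted_cycle_families V f ks" "xs \<in> rooted_cycles V f k" "set xs \<inter> set ys = {}"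
    using zs len by (auto simp: zs_eq rooted_cycle_families_def rooted_cycles_def)
  then show "zs \<in> (\<lambda>(ys, xs). xs @ ys) ` (SIGMA ys:rooted_cycle_families V f ks. {xs \<in> rooted_cycles V f k. set xs \<inter> set ys = {}})"
    unfolding zs_eq by (intro image_eqI[of _ _ "(ys, xs)"]) auto
qed (auto simp: rooted_cycle_families_def rooted_cycles_def)

section \<open>Cycles as orbits\<close>

lemma funpow_cycle_nth:
  assumes "map f xs = rotate1 xs" "i < length xs"
  shows "(f ^^ j) (xs ! i) = xs ! ((i + j) mod length xs)"
proof (induction j)
  case (Suc j)
  let ?l = "(i + j) mod length xs"
  have l: "?l < length xs" by (rule mod_less_divisor) (use assms in linarith)
  have "(f ^^ Suc j) (xs ! i) = map f xs ! ?l" using Suc l by simp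
  also have "\<dots> = xs ! ((i + Suc j) mod length xs)"
    using l by (simp add: assms(1) nth_rotate1 mod_Suc_eq)
  finally show ?case .
qed (use assms in simp)

text \<open>Indices along the cycle are taken modulo its length, so iteration from any entry reaches
  all entries and nothing else. Hence cycles that share a point have the same points.\<close>

lemma set_cycle_eq_orbit:
  assumes "map f xs = rotate1 xs" "x \<in> set xs"
  shows "set xs = range (\<lambda>j. (f ^^ j) x)"
proof -
  obtain i where i: "i < length xs" "x = xs ! i" using assms(2) by (metis in_set_conv_nth)
  show ?thesis
  proof (intro subset_antisym subsetI)
    fix y assume "y \<in> set xs"
    then obtain n where n: "n < length xs" "y = xs ! n" by (metis in_set_conv_nth)
    \<comment> \<open>The exponent is the distance from position \<open>i\<close> to
      \<open>n\<close>, raised by one full turn to stay nonnegative when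
      \<open>n < i\<close>.\<close>
    then have "(f ^^ (n + length xs - i)) x = y"
      using i by (simp add: funpow_cycle_nth[OF assms(1) i(1)])
    then show "y \<in> range (\<lambda>j. (f ^^ j) x)" by blast
  next
    fix y assume "y \<in> range (\<lambda>j. (f ^^ j) x)"
    then obtain j where "y = xs ! ((i + j) mod length xs)"
      using i by (auto simp: funpow_cycle_nth[OF assms(1) i(1)])
    moreover have "(i + j) mod length xs < length xs" by (rule mod_less_divisor) (use i in linarith)
    ultimately show "y \<in> set xs" by simp
  qed
qed

lemma rooted_cycles_meet:
  assumes "xs \<in> rooted_cycles V f k" "ys \<in> rooted_cycles V f k'" "x \<in> set xs" "x \<in> set ys"
  shows "set xs = set ys" and "k = k'"
proof -
  show *: "set xs = set ys"
    using assms set_cycle_eq_orbit[of f xs x] set_cycle_eq_orbit[of f ys x] by (simp add: rooted_cycles_def)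
  show "k = k'" using * assms(1,2) distinct_card[of xs] distinct_card[of ys] by (auto simp: rooted_cycles_def)
qed

lemma inj_on_hd_rooted_cycles: "inj_on hd (rooted_cycles V f k)"
proof (rule inj_onI)
  fix xs ys assume *: "xs \<in> rooted_cycles V f k" "ys \<in> rooted_cycles V f k" "hd xs = hd ys"
  show "xs = ys"
  proof (rule nth_equalityI)
    fix i assume i: "i < length xs"
    have nth: "zs ! i = (f ^^ i) (hd zs)" if "zs \<in> rooted_cycles V f k" "i < length zs" for zs
    proof -
      have "zs \<noteq> []" using that by auto
      then show ?thesis
        using that funpow_cycle_nth[of f zs 0 i] by (simp add: rooted_cycles_def hd_conv_nth)
    qed
    have "length xs = length ys" using * by (simp add: rooted_cycles_def)
    then show "xs ! i = ys ! i" using nth[OF *(1)] nth[OF *(2)] * i by simp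
  qed (use * in \<open>simp add: rooted_cycles_def\<close>)
qed

section \<open>Counting families by the points left on cycles\<close>

definition cycle_points :: "'a set \<Rightarrow> ('a \<Rightarrow> 'a) \<Rightarrow> nat \<Rightarrow> 'a set" where
  "cycle_points V f k = \<Union> (set ` rooted_cycles V f k)"

lemma cycle_points_subset: "cycle_points V f k \<subseteq> V"
  by (auto simp: cycle_points_def rooted_cycles_def)

text \<open>The cycles of length \<open>k\<close>, taken as point sets to forget their starting
  points, are pairwise disjoint and have \<open>k\<close> points each.\<close>

lemma card_cycle_points:
  assumes "finite V"
  shows "card (cycle_points V f k) = k * card (set ` rooted_cycles V f k)"
  unfolding cycle_points_def
proof (rule card_partition[symmetric])
  show "finite (\<Union> (set ` rooted_cycles V f k))"
    using cycle_points_subset assms finite_subset by (metis cycle_points_def)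
  show "card s = k" if "s \<in> set ` rooted_cycles V f k" for s
    using that distinct_card by (auto simp: rooted_cycles_def)
  show "s \<inter> t = {}" if "s \<in> set ` rooted_cycles V f k" "t \<in> set ` rooted_cycles V f k" "s \<noteq> t" for s t
    using that rooted_cycles_meet(1)[of _ V f k _ k] by blast
qed (simp add: assms finite_rooted_cycles)

lemma rotate_in_rooted_cycles: "xs \<in> rooted_cycles V f k \<Longrightarrow> rotate i xs \<in> rooted_cycles V f k"
  by (simp add: rooted_cycles_def rotate1_rotate_swap flip: rotate_map)

text \<open>The head gives a bijection. The points of \<open>ys\<close> are closed under
  \<open>f\<close>, so a cycle containing a point outside \<open>ys\<close> cannot meet
  \<open>ys\<close>; rotating it moves that point to the head.\<close>

lemma card_rooted_cycles_avoiding: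
  assumes "k > 0" and ys: "ys \<in> rooted_cycle_families V f ks"
  shows "card {xs \<in> rooted_cycles V f k. set xs \<inter> set ys = {}} = card (cycle_points V f k - set ys)"
proof -
  have closed: "f y \<in> set ys" if "y \<in> set ys" for y
    using that ys set_rotate_blocks[of ys ks] by (metis (mono_tags, lifting) rooted_cycle_families_def
      mem_Collect_eq image_eqI list.set_map)
  then have orbit: "(f ^^ j) y \<in> set ys" if "y \<in> set ys" for y j
    using that by (induction j) auto
  have ne: "xs \<noteq> []" if "xs \<in> rooted_cycles V f k" for xs
    using that assms by (auto simp: rooted_cycles_def)
  have "hd ` {xs \<in> rooted_cycles V f k. set xs \<inter> set ys = {}} = cycle_points V f k - set ys"
  proof (intro subset_antisym subsetI)
    fix x assume "x \<in> cycle_points V f k - set ys"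
    then obtain xs where xs: "xs \<in> rooted_cycles V f k" "x \<in> set xs" and x: "x \<notin> set ys"
      by (auto simp: cycle_points_def)
    obtain i where i: "i < length xs" "x = xs ! i" using xs(2) by (metis in_set_conv_nth)
    have "z \<notin> set ys" if "z \<in> set xs" for z
      using set_cycle_eq_orbit[of f xs z] xs that orbit[of z] x by (auto simp: rooted_cycles_def)
    then have "rotate i xs \<in> {xs \<in> rooted_cycles V f k. set xs \<inter> set ys = {}}"
      using rotate_in_rooted_cycles[OF xs(1)] by auto
    moreover have "hd (rotate i xs) = x" using i ne[OF xs(1)] by (simp add: hd_rotate_conv_nth)
    ultimately show "x \<in> hd ` {xs \<in> rooted_cycles V f k. set xs \<inter> set ys = {}}" by blast
  next
    fix x assume "x \<in> hd ` {xs \<in> rooted_cycles V f k. set xs \<inter> set ys = {}}"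
    then obtain xs where xs: "xs \<in> rooted_cycles V f k" "set xs \<inter> set ys = {}" "x = hd xs" by blast
    then have "x \<in> set xs" using ne by simp
    then show "x \<in> cycle_points V f k - set ys" using xs by (auto simp: cycle_points_def)
  qed
  then show ?thesis
    using card_image[OF inj_on_subset[OF inj_on_hd_rooted_cycles]]
    by (metis (no_types, lifting) mem_Collect_eq subsetI)
qed

text \<open>Each block of length \<open>k\<close> contributes its \<open>k\<close> points. Blocks of
  other lengths contribute none, since a point lies on cycles of one length only.\<close>

lemma card_cycle_points_in_family:
  assumes "k > 0" "ys \<in> rooted_cycle_families V f ks"
  shows "card (cycle_points V f k \<inter> set ys) = k * count_list ks k"
  using assms(2)
proof (induction ks arbitrary: ys)
  case Nil
  then show ?case by (simp add: rooted_cycle_families_Nil)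
next
  case (Cons k' ks)
  then obtain xs ys' where ys: "ys = xs @ ys'" "ys' \<in> rooted_cycle_families V f ks"
    "xs \<in> rooted_cycles V f k'" "set xs \<inter> set ys' = {}"
    by (auto simp: rooted_cycle_families_Cons)
  have "card (cycle_points V f k \<inter> set xs) = (if k' = k then k else 0)"
  proof (cases "k' = k")
    case True
    then have "cycle_points V f k \<inter> set xs = set xs" using ys by (auto simp: cycle_points_def)
    then show ?thesis using True ys distinct_card[of xs] by (simp add: rooted_cycles_def)
  next
    case False
    then have "cycle_points V f k \<inter> set xs = {}"
      using rooted_cycles_meet(2)[OF _ ys(3)] unfolding cycle_points_def by blast
    then show ?thesis using False by simp
  qed
  moreover have "card (cycle_points V f k \<inter> set ys)
      = card (cycle_points V f k \<inter> set xs) + card (cycle_points V f k \<inter> set ys')"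
    using ys by (subst card_Un_disjoint[symmetric]) (auto simp: Int_Un_distrib)
  ultimately show ?case using Cons.IH[OF ys(2)] by simp
qed

lemma card_rooted_cycle_families_Cons:
  assumes "finite V" "k > 0"
  shows "card (rooted_cycle_families V f (k # ks)) =
    card (rooted_cycle_families V f ks) * (k * (card (set ` rooted_cycles V f k) - count_list ks k))"
proof -
  let ?S = "SIGMA ys:rooted_cycle_families V f ks. {xs \<in> rooted_cycles V f k. set xs \<inter> set ys = {}}"
  have "inj_on (\<lambda>(ys, xs). xs @ ys) ?S"
    by (auto simp: inj_on_def rooted_cycles_def)
  then have "card (rooted_cycle_families V f (k # ks)) = card ?S"
    unfolding rooted_cycle_families_Cons by (rule card_image)
  also have "\<dots> = (\<Sum>ys\<in>rooted_cycle_families V f ks. card {xs \<in> rooted_cycles V f k. set xs \<inter> set ys = {}})"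
    using finite_rooted_cycle_families[OF assms(1)] finite_rooted_cycles[OF assms(1)] by simp
  also have "\<dots> = (\<Sum>ys\<in>rooted_cycle_families V f ks. k * (card (set ` rooted_cycles V f k) - count_list ks k))"
  proof (rule sum.cong[OF refl])
    fix ys assume ys: "ys \<in> rooted_cycle_families V f ks"
    have "card {xs \<in> rooted_cycles V f k. set xs \<inter> set ys = {}} = card (cycle_points V f k - set ys)"
      by (rule card_rooted_cycles_avoiding[OF assms(2) ys])
    also have "\<dots> = card (cycle_points V f k) - card (cycle_points V f k \<inter> set ys)"
      by (rule card_Diff_subset_Int) simp
    also have "\<dots> = k * (card (set ` rooted_cycles V f k) - count_list ks k)"
      by (simp add: card_cycle_points_in_family[OF assms(2) ys] card_cycle_points[OF assms(1)] diff_mult_distrib2)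
    finally show "card {xs \<in> rooted_cycles V f k. set xs \<inter> set ys = {}}
        = k * (card (set ` rooted_cycles V f k) - count_list ks k)" .
  qed
  finally show ?thesis by simp
qed

lemma Suc_times_binomial_Suc: "Suc j * (n choose Suc j) = (n - j) * (n choose j)"
  by (simp only: binomial_absorption binomial_absorb_comp)

text \<open>Each step of the recurrence contributes a factor \<open>k\<close> for the starting point
  and one factor of a falling factorial, which is written as \<open>fact n * (c choose n)\<close>.
  Lengths in \<open>K\<close> missing from \<open>ks\<close> contribute 1.\<close>

lemma card_rooted_cycle_families:
  assumes "finite V" "finite K" "set ks \<subseteq> K" "0 \<notin> K"
  shows "card (rooted_cycle_families V f ks) =
    (\<Prod>k\<in>K. k ^ count_list ks k * fact (count_list ks k)
        * (card (set ` rooted_cycles V f k) choose count_list ks k))"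
  using assms(3)
proof (induction ks)
  case Nil
  then show ?case by (simp add: rooted_cycle_families_Nil)
next
  case (Cons k ks)
  define c where "c i = card (set ` rooted_cycles V f i)" for i
  define g where "g i n = i ^ n * fact n * (c i choose n)" for i n :: nat
  have k: "k \<in> K" "k > 0" using Cons.prems assms(4) by (auto intro: gr0I)
  have IH: "card (rooted_cycle_families V f ks) = (\<Prod>i\<in>K. g i (count_list ks i))"
    using Cons unfolding g_def c_def by simp
  have step: "g i n * (i * (c i - n)) = g i (Suc n)" for i n
  proof -
    have "g i (Suc n) = i ^ Suc n * fact n * (Suc n * (c i choose Suc n))"
      by (simp only: g_def fact_Suc of_nat_id mult_ac)
    also have "\<dots> = g i n * (i * (c i - n))"
      unfolding Suc_times_binomial_Suc by (simp add: g_def mult_ac)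
    finally show ?thesis ..
  qed
  have "card (rooted_cycle_families V f (k # ks)) = (\<Prod>i\<in>K. g i (count_list ks i)) * (k * (c k - count_list ks k))"
    unfolding card_rooted_cycle_families_Cons[OF assms(1) k(2)] IH c_def ..
  also have "\<dots> = g k (Suc (count_list ks k)) * (\<Prod>i\<in>K - {k}. g i (count_list ks i))"
    by (simp add: prod.remove[OF assms(2) k(1)] flip: step)
  also have "\<dots> = (\<Prod>i\<in>K. g i (count_list (k # ks) i))"
    by (simp add: prod.remove[OF assms(2) k(1)])
  finally show ?case unfolding g_def c_def .
qed

section \<open>From digraph cycles to rooted cycles\<close>

lemma cas_functional_digraph:
  "pre_digraph.cas (functional_digraph R f) u (map (\<lambda>v. (v, ring.eval R f v)) xs) w \<longleftrightarrow>
     (if xs = [] then u = w else hd xs = u \<and> map (ring.eval R f) xs = tl xs @ [w])"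
proof (induction xs arbitrary: u)
  case (Cons x xs)
  then show ?case by (cases xs) (auto simp: pre_digraph.cas.simps functional_digraph_def)
qed (simp add: pre_digraph.cas.simps)

text \<open>An arc is determined by its tail, so a cycle is given by its list \<open>xs\<close> of
  tails, and closing up means that the list of images is \<open>rotate1 xs\<close>.\<close>

lemma cycle_functional_digraph_iff:
  assumes "k > 0"
  shows "pre_digraph.cycle (functional_digraph R f) p \<and> length p = k \<longleftrightarrow>
     p \<in> map (\<lambda>v. (v, ring.eval R f v)) ` rooted_cycles (carrier R) (ring.eval R f) k"
proof -
  let ?G = "functional_digraph R f" and ?e = "\<lambda>v. (v, ring.eval R f v)"
  have cyc: "pre_digraph.cycle ?G (map ?e xs) \<longleftrightarrow>
      distinct xs \<and> set xs \<subseteq> carrier R \<and> map (ring.eval R f) xs = rotate1 xs" if "xs \<noteq> []" for xs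
  proof -
    have "pre_digraph.awalk ?G u (map ?e xs) u \<longleftrightarrow>
        hd xs = u \<and> set xs \<subseteq> carrier R \<and> map (ring.eval R f) xs = rotate1 xs" for u
      unfolding pre_digraph.awalk_def cas_functional_digraph
      using that by (auto simp: functional_digraph_def rotate1_hd_tl)
    moreover have "distinct (tl (pre_digraph.awalk_verts ?G u (map ?e xs))) \<longleftrightarrow> distinct xs"
      if "pre_digraph.awalk ?G u (map ?e xs) u" and "map (ring.eval R f) xs = rotate1 xs" for u
    proof -
      \<comment> \<open>The vertices after the first are the heads of the arcs. They form
        \<open>rotate1 xs\<close>, so they are distinct exactly when \<open>xs\<close> is.\<close>
      have "tl (pre_digraph.awalk_verts ?G u (map ?e xs)) = map (ring.eval R f) xs"
        using that \<open>xs \<noteq> []\<close> by (subst pre_digraph.awalk_verts_conv'[where v = u])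
          (auto simp: pre_digraph.awalk_def functional_digraph_def comp_def)
      then show ?thesis using that by simp
    qed
    ultimately show ?thesis unfolding pre_digraph.cycle_def using that by auto
  qed
  have arcs: "\<exists>xs. p = map ?e xs" if "pre_digraph.cycle ?G p"
  proof -
    have "set p \<subseteq> arcs ?G" using that by (auto simp: pre_digraph.cycle_def pre_digraph.awalk_def)
    then have "p = map ?e (map fst p)"
      by (auto simp: functional_digraph_def intro!: nth_equalityI[symmetric] map_idI[symmetric])
    then show ?thesis by blast
  qed
  show ?thesis
  proof
    assume *: "pre_digraph.cycle ?G p \<and> length p = k"
    then obtain xs where "p = map ?e xs" using arcs by blast
    then show "p \<in> map ?e ` rooted_cycles (carrier R) (ring.eval R f) k"
      using * cyc[of xs] assms by (auto simp: rooted_cycles_def)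
  next
    assume "p \<in> map ?e ` rooted_cycles (carrier R) (ring.eval R f) k"
    then obtain xs where "p = map ?e xs" "xs \<in> rooted_cycles (carrier R) (ring.eval R f) k" by blast
    then show "pre_digraph.cycle ?G p \<and> length p = k"
      using cyc[of xs] assms by (auto simp: rooted_cycles_def)
  qed
qed

text \<open>Passing from a set of points to the set of arcs leaving them is injective, so both kinds
  of sets identify the same rotations.\<close>

lemma cycle_count_eq:
  assumes "k > 0"
  shows "cycle_count R k f = card (set ` rooted_cycles (carrier R) (ring.eval R f) k)"
proof -
  let ?e = "\<lambda>v. (v, ring.eval R f v)"
  have "{set p | p. pre_digraph.cycle (functional_digraph R f) p \<and> length p = k}
      = (`) ?e ` set ` rooted_cycles (carrier R) (ring.eval R f) k"
    unfolding cycle_functional_digraph_iff[OF assms] by (auto simp: image_image setcompr_eq_image)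
  moreover have "inj_on ((`) ?e) A" for A
    by (rule inj_on_subset[OF inj_on_image[of ?e]]) (auto simp: inj_on_def)
  ultimately show ?thesis unfolding cycle_count_def by (simp add: card_image)
qed

subsection \<open>Polynomials with prescribed values\<close>

lemma set_map2_subset:
  assumes "\<And>x y. x \<in> set xs \<Longrightarrow> y \<in> set ys \<Longrightarrow> f x y \<in> A"
  shows "set (map2 f xs ys) \<subseteq> A"
  using assms by (auto dest: set_zip_leftD set_zip_rightD)

lemma polys_of_degree_eq:
  "polys_of_degree R d = {f. length f = Suc d \<and> set f \<subseteq> carrier R \<and> hd f \<noteq> \<zero>\<^bsub>R\<^esub>}"
  unfolding polys_of_degree_def polynomial_def by auto

lemma finite_polys_of_degree: "finite (carrier R) \<Longrightarrow> finite (polys_of_degree R d)"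
  unfolding polys_of_degree_eq
  by (rule finite_subset[OF _ finite_lists_length_eq[of "carrier R" "Suc d"]]) auto

lemma (in field) polys_of_degree_nonempty: "polys_of_degree R d \<noteq> {}"
proof -
  have "\<one> # replicate d \<zero> \<in> polys_of_degree R d"
    by (auto simp: polys_of_degree_eq)
  then show ?thesis by blast
qed

lemma (in ring) eval_map2_add:
  assumes "length p = length q" "set p \<subseteq> carrier R" "set q \<subseteq> carrier R" "x \<in> carrier R"
  shows "eval (map2 (\<oplus>) p q) x = eval p x \<oplus> eval q x"
  using assms
proof (induction p q rule: list_induct2)
  case (Cons a p b q)
  have "eval p x \<in> carrier R" "eval q x \<in> carrier R" "x [^] length q \<in> carrier R"
    using Cons.prems eval_in_carrier by auto
  then show ?case using Cons by (simp add: l_distr a_ac)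
qed simp

lemma (in cring) eval_map_mult:
  assumes "c \<in> carrier R" "set p \<subseteq> carrier R" "x \<in> carrier R"
  shows "eval (map ((\<otimes>) c) p) x = c \<otimes> eval p x"
  using assms
proof (induction p)
  case (Cons a p)
  have "eval p x \<in> carrier R" using Cons.prems eval_in_carrier by auto
  then show ?case using Cons by (simp add: r_distr m_assoc)
qed simp

text \<open>Newton's scheme: if \<open>g\<close> takes the values \<open>(v - w) / (x - y)\<close>
  at the remaining points, then \<open>(x - y) * g + w\<close> takes the right values there and
  \<open>w\<close> at \<open>y\<close>. Leading zeros are allowed, so \<open>h\<close> is just a
  list of \<open>n\<close> coefficients.\<close>

lemma (in field) interpolation:
  assumes "distinct ys" "set ys \<subseteq> carrier R" "set ws \<subseteq> carrier R" "length ws = length ys" "length ys \<le> n"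
  shows "\<exists>h. length h = n \<and> set h \<subseteq> carrier R \<and> map (eval h) ys = ws"
  using assms
proof (induction ys arbitrary: ws n)
  case Nil
  then show ?case by (intro exI[of _ "replicate n \<zero>"]) auto
next
  case (Cons y ys)
  obtain w ws' where ws: "ws = w # ws'" using Cons.prems by (cases ws) auto
  obtain n' where n: "n = Suc n'" using Cons.prems by (cases n) auto
  have y: "y \<in> carrier R" and w: "w \<in> carrier R" using Cons.prems ws by auto
  have unit: "x \<ominus> y \<in> Units R" if "x \<in> set ys" for x
    using that Cons.prems y by (auto simp: field_Units)
  define vs where "vs = map2 (\<lambda>x v. (v \<ominus> w) \<otimes> inv (x \<ominus> y)) ys ws'"
  have "set vs \<subseteq> carrier R"
    unfolding vs_def using Cons.prems ws w unit by (intro set_map2_subset m_closed minus_closed Units_inv_closed) auto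
  then obtain g where g: "length g = n'" "set g \<subseteq> carrier R" "map (eval g) ys = vs"
    using Cons.IH[of vs n'] Cons.prems ws n by (auto simp: vs_def)
  \<comment> \<open>Coefficients start with the highest power: \<open>g @ [w]\<close> is
    \<open>g\<close> multiplied by the variable plus \<open>w\<close>, and the second list is
    \<open>- y\<close> times \<open>g\<close>, padded to equal length.\<close>
  define h where "h = map2 (\<oplus>) (g @ [w]) (\<zero> # map ((\<otimes>) (\<ominus> y)) g)"
  have eval_h: "eval h x = (x \<ominus> y) \<otimes> eval g x \<oplus> w" if "x \<in> carrier R" for x
  proof -
    have gx: "eval g x \<in> carrier R" using g that eval_in_carrier by auto
    have "set (map ((\<otimes>) (\<ominus> y)) g) \<subseteq> carrier R" using g y by auto
    then have "eval h x = (eval g x \<otimes> x \<oplus> w) \<oplus> (\<ominus> y) \<otimes> eval g x"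
      unfolding h_def using g y w that
      by (subst eval_map2_add) (auto simp: eval_append_aux eval_map_mult eval_in_carrier)
    moreover have "eval g x \<otimes> x = x \<otimes> eval g x" using gx that by (rule m_comm)
    ultimately show ?thesis using gx that y w by (simp add: minus_eq l_distr a_ac)
  qed
  have "eval h y = w" using eval_h[OF y] y w g eval_in_carrier by (simp add: minus_eq r_neg)
  moreover have "map (eval h) ys = ws'"
  proof (rule nth_equalityI)
    fix i assume "i < length (map (eval h) ys)"
    then have i: "i < length ys" by simp
    then have x: "ys ! i \<in> carrier R" "ys ! i \<in> set ys" and v: "ws' ! i \<in> carrier R"
      using Cons.prems ws by (auto simp: subset_iff)
    have "eval g (ys ! i) = vs ! i" using g(3) i by (metis nth_map)
    then have "eval g (ys ! i) = (ws' ! i \<ominus> w) \<otimes> inv (ys ! i \<ominus> y)"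
      using i Cons.prems ws by (simp add: vs_def)
    then have "eval h (ys ! i) = (ws' ! i \<ominus> w) \<otimes> ((ys ! i \<ominus> y) \<otimes> inv (ys ! i \<ominus> y)) \<oplus> w"
      using eval_h[OF x(1)] unit[OF x(2)] v w x y by (simp add: m_lcomm)
    also have "\<dots> = ws' ! i"
      using unit[OF x(2)] v w by (simp add: minus_eq a_assoc l_neg)
    finally show "map (eval h) ys ! i = ws' ! i" using i by simp
  qed (use Cons.prems ws in auto)
  moreover have "length h = n" using g n by (simp add: h_def)
  moreover have "set h \<subseteq> carrier R"
  proof -
    have "set (\<zero> # map ((\<otimes>) (\<ominus> y)) g) \<subseteq> carrier R" "set (g @ [w]) \<subseteq> carrier R" using g y w by auto
    then show ?thesis unfolding h_def by (intro set_map2_subset a_closed) auto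
  qed
  ultimately show ?case using ws by auto
qed

text \<open>Adding a polynomial that interpolates the differences \<open>zs' - zs\<close> maps the
  first set injectively into the second. Exchanging \<open>zs\<close> and \<open>zs'\<close> gives
  the reverse inequality.\<close>

lemma (in field) card_polys_with_values_le:
  assumes fin: "finite (carrier R)" and ys: "distinct ys" "set ys \<subseteq> carrier R" "length ys \<le> d"
    and zs: "set zs \<subseteq> carrier R" "length zs = length ys" and zs': "set zs' \<subseteq> carrier R" "length zs' = length ys"
  shows "card {f \<in> polys_of_degree R d. map (eval f) ys = zs} \<le> card {f \<in> polys_of_degree R d. map (eval f) ys = zs'}"
proof -
  have "set (map2 (\<lambda>a b. a \<ominus> b) zs' zs) \<subseteq> carrier R"
    using zs zs' by (intro set_map2_subset minus_closed) auto
  then obtain h where h: "length h = d" "set h \<subseteq> carrier R" "map (eval h) ys = map2 (\<lambda>a b. a \<ominus> b) zs' zs"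
    using interpolation[OF ys(1,2), of "map2 (\<lambda>a b. a \<ominus> b) zs' zs" d] ys zs zs' by auto
  \<comment> \<open>The prepended zero brings \<open>h\<close> to length \<open>Suc d\<close> and
    leaves the leading coefficient of \<open>f\<close> unchanged, so the degree stays exactly
    \<open>d\<close>.\<close>
  define \<phi> where "\<phi> f = map2 (\<oplus>) f (\<zero> # h)" for f
  have "inj_on \<phi> (polys_of_degree R d)"
  proof (rule inj_onI)
    fix f g assume fg: "f \<in> polys_of_degree R d" "g \<in> polys_of_degree R d" "\<phi> f = \<phi> g"
    have *: "(\<zero> # h) ! i \<in> carrier R" if "i < Suc d" for i
      using h that nth_mem[of i "\<zero> # h"] by auto
    show "f = g"
    proof (rule nth_equalityI)
      fix i assume "i < length f"
      then have i: "i < Suc d" "f ! i \<in> carrier R" "g ! i \<in> carrier R"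
        using fg by (auto simp: polys_of_degree_eq subset_iff)
      have "\<phi> p ! i = p ! i \<oplus> (\<zero> # h) ! i" if "p \<in> polys_of_degree R d" for p
        using that i h by (simp add: \<phi>_def polys_of_degree_eq)
      then have "f ! i \<oplus> (\<zero> # h) ! i = g ! i \<oplus> (\<zero> # h) ! i"
        using fg by metis
      then show "f ! i = g ! i" using i *[OF i(1)] by (metis a_comm add.l_cancel)
    qed (use fg in \<open>auto simp: polys_of_degree_eq\<close>)
  qed
  moreover have "\<phi> f \<in> {f \<in> polys_of_degree R d. map (eval f) ys = zs'}"
    if "f \<in> polys_of_degree R d" "map (eval f) ys = zs" for f
  proof -
    have f: "length f = Suc d" "set f \<subseteq> carrier R" "hd f \<noteq> \<zero>"
      using that(1) by (auto simp: polys_of_degree_eq)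
    then obtain a p where ap: "f = a # p" by (cases f) auto
    have "set (map2 (\<oplus>) p h) \<subseteq> carrier R" using f h ap by (intro set_map2_subset a_closed) auto
    then have "\<phi> f \<in> polys_of_degree R d" using f h ap by (simp add: \<phi>_def polys_of_degree_eq)
    moreover have "map (eval (\<phi> f)) ys = zs'"
    proof (rule nth_equalityI)
      fix i assume "i < length (map (eval (\<phi> f)) ys)"
      then have i: "i < length ys" by simp
      then have x: "ys ! i \<in> carrier R" "zs' ! i \<in> carrier R"
        using ys zs' by (auto simp: subset_iff)
      have fx: "eval f (ys ! i) \<in> carrier R" using f x eval_in_carrier by auto
      have "eval h (ys ! i) = map (eval h) ys ! i" using i by simp
      also have "\<dots> = zs' ! i \<ominus> zs ! i" using i zs zs' by (simp add: h(3))
      also have "zs ! i = eval f (ys ! i)" using i that(2) by auto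
      finally have "eval h (ys ! i) = zs' ! i \<ominus> eval f (ys ! i)" .
      moreover have "eval (\<phi> f) (ys ! i) = eval f (ys ! i) \<oplus> eval h (ys ! i)"
        unfolding \<phi>_def using f h x by (subst eval_map2_add) (auto simp: eval_in_carrier)
      ultimately show "map (eval (\<phi> f)) ys ! i = zs' ! i"
        using x fx i by (simp add: minus_eq a_lcomm r_neg)
    qed (use zs' in simp)
    ultimately show ?thesis by blast
  qed
  ultimately show ?thesis
    using finite_polys_of_degree[OF fin, of d]
    by (intro card_inj_on_le[of \<phi>]) (auto intro: inj_on_subset)
qed

text \<open>The value patterns on \<open>ys\<close> split the polynomials into
  \<open>card (carrier R) ^ length ys\<close> classes, all of equal size.\<close>

lemma (in field) card_polys_with_values:
  assumes fin: "finite (carrier R)" and ys: "distinct ys" "set ys \<subseteq> carrier R" "length ys \<le> d"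
    and zs: "set zs \<subseteq> carrier R" "length zs = length ys"
  shows "card {f \<in> polys_of_degree R d. map (eval f) ys = zs} * card (carrier R) ^ length ys = card (polys_of_degree R d)"
proof -
  define N where "N us = {f \<in> polys_of_degree R d. map (eval f) ys = us}" for us
  define V where "V = {us. set us \<subseteq> carrier R \<and> length us = length ys}"
  have "polys_of_degree R d = (\<Union>us\<in>V. N us)"
    using ys(2) by (auto simp: N_def V_def polys_of_degree_eq intro!: eval_in_carrier)
  then have "card (polys_of_degree R d) = (\<Sum>us\<in>V. card (N us))"
  proof (simp only:, intro card_UN_disjoint ballI impI)
    show "finite V" unfolding V_def by (rule finite_lists_length_eq[OF fin])
    show "finite (N us)" for us using finite_polys_of_degree[OF fin, of d] by (simp add: N_def)
    show "N us \<inter> N us' = {}" if "us \<noteq> us'" for us us' using that by (auto simp: N_def)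
  qed
  also have "\<dots> = (\<Sum>us\<in>V. card (N zs))"
    using card_polys_with_values_le[OF fin ys] zs by (intro sum.cong) (auto simp: N_def V_def intro!: antisym)
  also have "\<dots> = card (carrier R) ^ length ys * card (N zs)"
    by (simp add: V_def card_lists_length_eq[OF fin])
  finally show ?thesis by (simp add: N_def mult.commute)
qed

subsection \<open>Cycle counts of random polynomials\<close>

text \<open>Double counting of pairs of a polynomial and a rooted family in it. For a fixed list of
  points, being a family prescribes the values at \<open>sum_list ks \<le> d\<close> distinct
  points.\<close>

lemma (in field) sum_card_rooted_cycle_families:
  assumes fin: "finite (carrier R)" and d: "sum_list ks \<le> d"
  shows "(\<Sum>f\<in>polys_of_degree R d. card (rooted_cycle_families (carrier R) (eval f) ks)) * card (carrier R) ^ sum_list ks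
    = card {ys. length ys = sum_list ks \<and> distinct ys \<and> set ys \<subseteq> carrier R} * card (polys_of_degree R d)"
proof -
  define Y where "Y = {ys. length ys = sum_list ks \<and> distinct ys \<and> set ys \<subseteq> carrier R}"
  define \<Omega> where "\<Omega> = polys_of_degree R d"
  have finY: "finite Y"
    unfolding Y_def by (rule finite_subset[OF _ finite_lists_length_eq[OF fin, of "sum_list ks"]]) auto
  have fin\<Omega>: "finite \<Omega>" unfolding \<Omega>_def by (rule finite_polys_of_degree[OF fin])
  have "(\<Sum>f\<in>\<Omega>. card (rooted_cycle_families (carrier R) (eval f) ks))
      = (\<Sum>f\<in>\<Omega>. \<Sum>ys\<in>Y. of_bool (map (eval f) ys = rotate_blocks ks ys))"
  proof (rule sum.cong[OF refl])
    fix f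
    have "rooted_cycle_families (carrier R) (eval f) ks = Y \<inter> {ys. map (eval f) ys = rotate_blocks ks ys}"
      by (auto simp: Y_def rooted_cycle_families_def)
    then show "card (rooted_cycle_families (carrier R) (eval f) ks)
        = (\<Sum>ys\<in>Y. of_bool (map (eval f) ys = rotate_blocks ks ys))"
      using finY by simp
  qed
  also have "\<dots> = (\<Sum>ys\<in>Y. \<Sum>f\<in>\<Omega>. of_bool (map (eval f) ys = rotate_blocks ks ys))"
    by (rule sum.swap)
  also have "\<dots> = (\<Sum>ys\<in>Y. card {f \<in> \<Omega>. map (eval f) ys = rotate_blocks ks ys})"
    using fin\<Omega> by (simp add: Collect_conj_eq)
  finally have swap: "(\<Sum>f\<in>\<Omega>. card (rooted_cycle_families (carrier R) (eval f) ks))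
      = (\<Sum>ys\<in>Y. card {f \<in> \<Omega>. map (eval f) ys = rotate_blocks ks ys})" .
  have "(\<Sum>f\<in>\<Omega>. card (rooted_cycle_families (carrier R) (eval f) ks)) * card (carrier R) ^ sum_list ks
      = (\<Sum>ys\<in>Y. card {f \<in> \<Omega>. map (eval f) ys = rotate_blocks ks ys} * card (carrier R) ^ length ys)"
    unfolding swap sum_distrib_right by (intro sum.cong) (auto simp: Y_def)
  also have "\<dots> = (\<Sum>ys\<in>Y. card \<Omega>)"
    unfolding \<Omega>_def
    by (intro sum.cong refl card_polys_with_values[OF fin])
      (use d in \<open>auto simp: Y_def set_rotate_blocks length_rotate_blocks\<close>)
  finally show ?thesis by (simp add: Y_def \<Omega>_def)
qed

text \<open>Once \<open>q\<close> is positive and \<open>s \<le> q\<close>, the quotient is the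
  product of \<open>1 - i / q\<close> over \<open>i < s\<close>, a fixed number of factors tending
  to 1.\<close>

lemma tendsto_falling_product: "(\<lambda>q. real (\<Prod>{q - s + 1..q}) / real q ^ s) \<longlonglongrightarrow> 1"
proof -
  have falling: "real (\<Prod>{q - s + 1..q}) = (\<Prod>i<s. real q - real i)" if "s \<le> q" for q
    using that
  proof (induction s)
    case (Suc s)
    then have "\<Prod>{q - Suc s + 1..q} = (q - s) * \<Prod>{q - s + 1..q}"
      using prod.atLeast_Suc_atMost[of "q - s" q "\<lambda>x. x"] by (simp add: Suc_diff_Suc)
    then show ?case using Suc by simp
  qed simp
  have "\<forall>\<^sub>F q in sequentially. (\<Prod>i<s. 1 - real i / real q) = real (\<Prod>{q - s + 1..q}) / real q ^ s"
    using eventually_ge_at_top[of "max 1 s"]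
  proof eventually_elim
    case (elim q)
    have "(\<Prod>i<s. 1 - real i / real q) = (\<Prod>i<s. (real q - real i) / real q)"
      using elim by (intro prod.cong) (auto simp: field_simps)
    then show ?case using elim falling[of q] by (simp add: prod_dividef)
  qed
  moreover have "(\<lambda>q. \<Prod>i<s. 1 - real i / real q) \<longlonglongrightarrow> (\<Prod>i<s. 1 - 0)"
    by (intro tendsto_prod tendsto_diff tendsto_const lim_const_over_n)
  ultimately show ?thesis by (simp add: tendsto_cong)
qed

lemma exists_list_with_counts:
  assumes "finite K"
  shows "\<exists>ks. set ks \<subseteq> K \<and> (\<forall>k\<in>K. count_list ks k = r k)"
  using assms
proof (induction K rule: finite_induct)
  case (insert x K)
  then obtain ks where ks: "set ks \<subseteq> K" "\<forall>k\<in>K. count_list ks k = r k" by blast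
  have rep: "count_list (replicate n x) y = (if x = y then n else 0)" for n y
    by (induction n) auto
  have "count_list ks x = 0" using ks(1) insert by (auto simp: count_list_0_iff)
  then show ?case
    using ks insert by (intro exI[of _ "replicate (r x) x @ ks"]) (auto simp: rep)
qed simp

lemma eventually_primepow: "\<forall>\<^sub>F q in primepow_at_top. primepow q"
  by (simp add: primepow_at_top_def eventually_inf_principal)

text \<open>As soon as \<open>s \<le> q\<close> and \<open>s \<le> d q\<close>, which holds
  eventually, the moment equals the falling product over \<open>q ^ s\<close>, divided by
  \<open>w\<close>.\<close>

lemma tendsto_cycle_count_moments:
  fixes F :: "nat \<Rightarrow> ('a, 'c) ring_scheme" and d :: "nat \<Rightarrow> nat" and r :: "nat \<Rightarrow> nat"
  assumes F: "\<And>q. primepow q \<Longrightarrow> field (F q) \<and> card (carrier (F q)) = q"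
    and d: "filterlim d at_top primepow_at_top"
    and K: "finite K" "0 \<notin> K"
  shows "((\<lambda>q. (\<Sum>f\<in>polys_of_degree (F q) (d q). \<Prod>k\<in>K. real (cycle_count (F q) k f choose r k))
              / real (card (polys_of_degree (F q) (d q))))
      \<longlongrightarrow> (\<Prod>k\<in>K. (1 / real k) ^ r k / fact (r k))) primepow_at_top"
proof -
  obtain ks where ks: "set ks \<subseteq> K" "\<And>k. k \<in> K \<Longrightarrow> count_list ks k = r k"
    using exists_list_with_counts[OF K(1), of r] by blast
  define s where "s = sum_list ks"
  \<comment> \<open>For chosen sets of \<open>r k\<close> cycles of each length \<open>k\<close>,
    \<open>w\<close> counts the ways to order each set and to pick a starting point on every
    cycle.\<close>
  define w where "w = (\<Prod>k\<in>K. real k ^ r k * fact (r k))"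
  have w: "w \<noteq> 0" using K by (auto simp: w_def)
  have "\<forall>\<^sub>F q in primepow_at_top. real (\<Prod>{q - s + 1..q}) / real q ^ s / w
      = (\<Sum>f\<in>polys_of_degree (F q) (d q). \<Prod>k\<in>K. real (cycle_count (F q) k f choose r k))
              / real (card (polys_of_degree (F q) (d q)))"
  proof -
    have "\<forall>\<^sub>F q in primepow_at_top. s \<le> d q"
      using d by (simp add: filterlim_at_top)
    moreover have "\<forall>\<^sub>F q in primepow_at_top. s \<le> q"
      unfolding primepow_at_top_def eventually_inf_principal
      using eventually_ge_at_top[of s] by eventually_elim simp
    ultimately show ?thesis using eventually_primepow
    proof eventually_elim
      case (elim q)
      define \<Omega> where "\<Omega> = polys_of_degree (F q) (d q)"
      define C where "C f = card (rooted_cycle_families (carrier (F q)) (ring.eval (F q) f) ks)" for f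
      interpret Fq: field "F q" using F elim by blast
      have q: "card (carrier (F q)) = q" "q > 0" using F elim primepow_gt_0_nat by auto
      have fin: "finite (carrier (F q))" using q card_ge_0_finite by metis
      have \<Omega>: "card \<Omega> > 0"
        using finite_polys_of_degree[OF fin] Fq.polys_of_degree_nonempty by (simp add: \<Omega>_def card_gt_0_iff)
      have "real (C f) = w * (\<Prod>k\<in>K. real (cycle_count (F q) k f choose r k))" for f
      proof -
        have "C f = (\<Prod>k\<in>K. k ^ r k * fact (r k) * (cycle_count (F q) k f choose r k))"
          unfolding C_def card_rooted_cycle_families[OF fin K(1) ks(1) K(2)]
        proof (rule prod.cong[OF refl])
          fix k assume "k \<in> K"
          moreover from this have "k > 0" using K(2) by (metis gr0I)
          ultimately show "k ^ count_list ks k * fact (count_list ks k) *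
              (card (set ` rooted_cycles (carrier (F q)) (ring.eval (F q) f) k) choose count_list ks k)
              = k ^ r k * fact (r k) * (cycle_count (F q) k f choose r k)"
            by (simp only: ks(2) cycle_count_eq)
        qed
        then show ?thesis by (simp add: w_def prod.distrib)
      qed
      then have C_sum: "w * (\<Sum>f\<in>\<Omega>. \<Prod>k\<in>K. real (cycle_count (F q) k f choose r k)) = real (\<Sum>f\<in>\<Omega>. C f)"
        by (simp add: sum_distrib_left)
      have "(\<Sum>f\<in>\<Omega>. C f) * q ^ s = \<Prod>{q - s + 1..q} * card \<Omega>"
        using Fq.sum_card_rooted_cycle_families[OF fin, of ks "d q"] card_lists_distinct_length_eq[OF fin, of s] elim
        by (simp add: q s_def C_def \<Omega>_def)
      then have "real (\<Sum>f\<in>\<Omega>. C f) * real q ^ s = real (\<Prod>{q - s + 1..q}) * real (card \<Omega>)"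
        by (metis of_nat_mult of_nat_power)
      then have "real (\<Prod>{q - s + 1..q}) * real (card \<Omega>)
          = (\<Sum>f\<in>\<Omega>. \<Prod>k\<in>K. real (cycle_count (F q) k f choose r k)) * (real q ^ s * w)"
        unfolding C_sum[symmetric] by (simp only: mult_ac)
      then show ?case
        unfolding \<Omega>_def[symmetric] divide_divide_eq_left
        by (subst frac_eq_eq) (use w \<Omega> q(2) in simp_all)
    qed
  qed
  moreover have "((\<lambda>q. real (\<Prod>{q - s + 1..q}) / real q ^ s / w) \<longlongrightarrow> 1 / w) primepow_at_top"
  proof (rule tendsto_mono)
    show "primepow_at_top \<le> at_top" by (simp add: primepow_at_top_def)
    show "(\<lambda>q. real (\<Prod>{q - s + 1..q}) / real q ^ s / w) \<longlonglongrightarrow> 1 / w"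
      by (intro tendsto_divide tendsto_falling_product tendsto_const w)
  qed
  moreover have "1 / w = (\<Prod>k\<in>K. (1 / real k) ^ r k / fact (r k))"
    by (simp add: w_def power_divide prod_dividef prod.distrib)
  ultimately show ?thesis by (simp add: tendsto_cong)
qed

theorem theorem1:
  fixes F :: "nat \<Rightarrow> ('a, 'c) ring_scheme"
    and d :: "nat \<Rightarrow> nat"
    and b :: nat
    and m :: "nat \<Rightarrow> nat"
  assumes "\<And>q. primepow q \<Longrightarrow> field (F q) \<and> card (carrier (F q)) = q"
    and "\<And>q. primepow q \<Longrightarrow> d q \<ge> 1"
    and "filterlim d at_top primepow_at_top"
    and "b \<ge> 1"
  shows "((\<lambda>q. measure (poly_measure (F q) (d q))
             {f \<in> space (poly_measure (F q) (d q)). \<forall>k\<in>{1..b}. cycle_count (F q) k f = m k})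
          \<longlongrightarrow> (\<Prod>k=1..b. exp (- (1 / real k)) * (1 / (fact (m k) * real k ^ m k))))
         primepow_at_top"
proof -
  let ?p = "\<lambda>q. real (card {f \<in> polys_of_degree (F q) (d q). \<forall>k\<in>{1..b}. cycle_count (F q) k f = m k})
      / real (card (polys_of_degree (F q) (d q)))"
  have "(?p \<longlongrightarrow> (\<Prod>k=1..b. exp (- (1 / real k)) * ((1 / real k) ^ m k / fact (m k)))) primepow_at_top"
    by (intro poisson_method_of_moments tendsto_cycle_count_moments assms) auto
  moreover have "(1 / real k) ^ m k / fact (m k) = 1 / (fact (m k) * real k ^ m k)" for k
    by (simp add: power_divide)
  \<comment> \<open>For a prime power the carrier is finite, so the uniform measure of the event is
    the ratio of the two cardinalities.\<close>
  moreover have "\<forall>\<^sub>F q in primepow_at_top. ?p q = measure (poly_measure (F q) (d q))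
      {f \<in> space (poly_measure (F q) (d q)). \<forall>k\<in>{1..b}. cycle_count (F q) k f = m k}"
    using eventually_primepow
  proof eventually_elim
    case (elim q)
    then have "finite (carrier (F q))"
      using assms(1)[of q] primepow_gt_0_nat[of q] card_ge_0_finite by metis
    then have "finite (polys_of_degree (F q) (d q))" by (rule finite_polys_of_degree)
    then show ?case
      unfolding poly_measure_def space_uniform_count_measure
      by (intro measure_uniform_count_measure[symmetric]) auto
  qed
  ultimately show ?thesis by (simp only: tendsto_cong)
qed

end
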